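(* Let $V$ be a finite set with $|V|=n$, and let $F\subseteq 2^V\setminus\{\emptyset,V\}$ be an explicitly given crossing family with $|F|=m$. (i) If every $U\in F$ contains an element $u$ and excludes an element $v$ such that $V\setminus\{u\}\notin F$ and $\{v\}\notin F$, then the Cosigning Forcing Algorithm outputs a cosigning of $F$ and has running time at most $m\cdot\binom{n+1}{2}$. (ii) If for all $Z,T\in F$ with $Z\cap T\ne\emptyset$ there is $u\in Z\cap T$ with $V\setminus\{u\}\neq B\cup W$ for all $B,W\in F$, and for all $X,Y\in F$ with $X\cup Y\neq V$ there is $v\in V\setminus (X\cup Y)$ with $\{v\}\neq H\cap G$ for all $G,H\in F$, then the $\cap\cup$-Closed Cosigning Forcing Algorithm outputs a $\cap\cup$-closed cosigning of $F$ and has running time at most $2\cdot\binom{m}{2}\cdot\binom{n+1}{2}$.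
   Context: A family $F$ of subsets of $V$ is a crossing family if $U\cap W, U\cup W\in F$ for all $U,W\in F$ with $U\cap W\neq\emptyset$ and $U\cup W\neq V$. A cosigning of $F$ is a function $\sigma:V\to\{+,-\}$ such that every $U\in F$ contains a positive element and excludes a negative element. A $\cap\cup$-closed cosigning of $F$ is a function $\sigma:V\to\{+,-\}$ such that $X\cap Y$ contains a positive element for all $X,Y\in F$ (possibly equal) with $X\cap Y\ne\emptyset$, and $V\setminus(X\cup Y)$ contains a negative element for all $X,Y\in F$ (possibly equal) with $X\cup Y\neq V$. Cosigning Forcing Algorithm: start with all elements unsigned and sign elements one at a time. Given the current partial signing, an unsigned element $v$ is forced to be positive if there is $U\in F$ with $v\in U$ and all elements of $U\setminus\{v\}$ negatively signed (trivially forced if $\{v\}\in F$); it is forced to be negative if there is $W\in F$ with $v\notin W$ and all elements of $V\setminus(W\cup\{v\})$ positively signed (trivially forced if $V\setminus\{v\}\in F$). First sign all trivially forced elements accordingly. Then repeat until all elements are signed: if there is an unsigned forced element, sign it accordingly; otherwise pick an unsigned element and sign it arbitrarily. $\cap\cup$-Closed Cosigning Forcing Algorithm: the same procedure, where an unsigned $v$ is forced to be positive if there are $Z,T\in F$, possibly equal, with $v\in Z\cap T$ and all other elements of $Z\cap T$ negatively signed (trivially if $Z\cap T=\{v\}$), and forced to be negative if there are $X,Y\in F$, possibly equal, with $v\notin X\cup Y$ and all other elements of $V\setminus(X\cup Y)$ positively signed (trivially if $X\cup Y=V\setminus\{v\}$). Running time is counted as follows: in an iteration with $n'$ unsigned elements,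 the search for an unsigned forced element goes through each set of $F$ at most once and is counted as time at most $m n'$ for the Cosigning Forcing Algorithm; it goes through each pair of sets of $F$ twice and is counted as time at most $2\binom{m}{2}n'$ for the $\cap\cup$-closed variant. The total is the sum over $n'=1,\dots,n$. *)

theory Defs
  imports Main
begin

definition crossing_family :: "'a set \<Rightarrow> 'a set set \<Rightarrow> bool" where
  "crossing_family V F \<longleftrightarrow> F \<subseteq> Pow V \<and>
     (\<forall>U\<in>F. \<forall>W\<in>F. U \<inter> W \<noteq> {} \<and> U \<union> W \<noteq> V \<longrightarrow> U \<inter> W \<in> F \<and> U \<union> W \<in> F)"

datatype sign = Pos | Neg

definition cosigning :: "'a set \<Rightarrow> 'a set set \<Rightarrow> ('a \<Rightarrow> sign) \<Rightarrow> bool" where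
  "cosigning V F \<sigma> \<longleftrightarrow>
     (\<forall>U\<in>F. (\<exists>u\<in>U. \<sigma> u = Pos) \<and> (\<exists>v\<in>V - U. \<sigma> v = Neg))"

definition int_un_closed_cosigning :: "'a set \<Rightarrow> 'a set set \<Rightarrow> ('a \<Rightarrow> sign) \<Rightarrow> bool" where
  "int_un_closed_cosigning V F \<sigma> \<longleftrightarrow>
     (\<forall>X\<in>F. \<forall>Y\<in>F. X \<inter> Y \<noteq> {} \<longrightarrow> (\<exists>u\<in>X \<inter> Y. \<sigma> u = Pos)) \<and>
     (\<forall>X\<in>F. \<forall>Y\<in>F. X \<union> Y \<noteq> V \<longrightarrow> (\<exists>v\<in>V - (X \<union> Y). \<sigma> v = Neg))"

type_synonym 'a signing = "'a \<rightharpoonup> sign"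

definition unsigned :: "'a set \<Rightarrow> 'a signing \<Rightarrow> 'a set" where
  "unsigned V s = {v \<in> V. s v = None}"

text \<open>
  \<open>forces V s S v x\<close>: the set \<open>S\<close> forces the unsigned element \<open>v\<close> to receive the sign \<open>x\<close>.
  Here \<open>S\<close> is a member of the family for the first algorithm; for the second one it is an
  intersection (if \<open>x = Pos\<close>) or a union (if \<open>x = Neg\<close>) of two members.
\<close>
fun forces :: "'a set \<Rightarrow> 'a signing \<Rightarrow> 'a set \<Rightarrow> 'a \<Rightarrow> sign \<Rightarrow> bool" where
  "forces V s S v Pos \<longleftrightarrow> v \<in> unsigned V s \<and> v \<in> S \<and> (\<forall>u\<in>S - {v}. s u = Some Neg)"
| "forces V s S v Neg \<longleftrightarrow> v \<in> unsigned V s \<and> v \<notin> S \<and> (\<forall>u\<in>V - (S \<union> {v}). s u = Some Pos)"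

fun trivially_forces :: "'a set \<Rightarrow> 'a signing \<Rightarrow> 'a set \<Rightarrow> 'a \<Rightarrow> sign \<Rightarrow> bool" where
  "trivially_forces V s S v Pos \<longleftrightarrow> v \<in> unsigned V s \<and> S = {v}"
| "trivially_forces V s S v Neg \<longleftrightarrow> v \<in> unsigned V s \<and> S = V - {v}"

text \<open>
  A search procedure is a relation \<open>search k R r t\<close>: with \<open>k\<close> unsigned elements left and \<open>R\<close> as
  the forcing relation, the search may return \<open>r\<close> (an element with its forced sign, or \<open>None\<close> if
  nothing is forced) within counted time \<open>t\<close>.
\<close>
type_synonym 'a search =
  "nat \<Rightarrow> ('a set \<Rightarrow> 'a \<Rightarrow> sign \<Rightarrow> bool) \<Rightarrow> ('a \<times> sign) option \<Rightarrow> nat \<Rightarrow> bool"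

text \<open>
  \<open>I\<close> is the collection of inspected sets: each set of \<open>F\<close> is inspected at most once, in an
  arbitrary order, at a cost of at most \<open>k\<close>. The search may stop as soon as it succeeds.
\<close>
inductive cosigning_search :: "'a set set \<Rightarrow> 'a search" for F k R where
  found: "\<lbrakk>I \<subseteq> F; U \<in> I; R U v x; t \<le> card I * k\<rbrakk>
    \<Longrightarrow> cosigning_search F k R (Some (v, x)) t"
| exhausted: "\<lbrakk>\<forall>U\<in>F. \<forall>v x. \<not> R U v x; t \<le> card F * k\<rbrakk>
    \<Longrightarrow> cosigning_search F k R None t"

definition set_pairs :: "'a set set \<Rightarrow> 'a set set set" where
  "set_pairs F = {P. P \<subseteq> F \<and> card P = 2}"

text \<open>
  Every pair is inspected at most twice: once for its intersection (the pairs in \<open>I\<close>) and once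
  for its union (the pairs in \<open>J\<close>). Two equal members of \<open>F\<close> are admissible witnesses, but
  time is counted only for the \<open>card F choose 2\<close> pairs of distinct members.
\<close>
inductive int_un_search :: "'a set set \<Rightarrow> 'a search" for F k R where
  found_pos: "\<lbrakk>I \<subseteq> set_pairs F; J \<subseteq> set_pairs F; Z \<in> F; T \<in> F; Z = T \<or> {Z, T} \<in> I;
      R (Z \<inter> T) v Pos; t \<le> (card I + card J) * k\<rbrakk>
    \<Longrightarrow> int_un_search F k R (Some (v, Pos)) t"
| found_neg: "\<lbrakk>I \<subseteq> set_pairs F; J \<subseteq> set_pairs F; X \<in> F; Y \<in> F; X = Y \<or> {X, Y} \<in> J;
      R (X \<union> Y) v Neg; t \<le> (card I + card J) * k\<rbrakk>
    \<Longrightarrow> int_un_search F k R (Some (v, Neg)) t"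
| exhausted: "\<lbrakk>\<forall>Z\<in>F. \<forall>T\<in>F. \<forall>v. \<not> R (Z \<inter> T) v Pos; \<forall>X\<in>F. \<forall>Y\<in>F. \<forall>v. \<not> R (X \<union> Y) v Neg;
      t \<le> (card (set_pairs F) + card (set_pairs F)) * k\<rbrakk>
    \<Longrightarrow> int_un_search F k R None t"

text \<open>
  One iteration signs exactly one element. Which of several forced elements is found, and how an
  unforced element is chosen and signed, is nondeterministic. An element forced to both signs
  could be given either one. The rule \<open>free\<close> needs no separate guard for trivially forced
  elements, because these are in particular forced.
\<close>
inductive iteration :: "'a set \<Rightarrow> 'a search \<Rightarrow> 'a signing \<Rightarrow> nat \<Rightarrow> 'a signing \<Rightarrow> bool"
  for V search where
  trivial: "search (card (unsigned V s)) (trivially_forces V s) (Some (v, x)) t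
    \<Longrightarrow> iteration V search s t (s(v \<mapsto> x))"
| forced: "\<lbrakk>\<nexists>w y t'. search (card (unsigned V s)) (trivially_forces V s) (Some (w, y)) t';
      search (card (unsigned V s)) (forces V s) (Some (v, x)) t\<rbrakk>
    \<Longrightarrow> iteration V search s t (s(v \<mapsto> x))"
| free: "\<lbrakk>search (card (unsigned V s)) (forces V s) None t; v \<in> unsigned V s\<rbrakk>
    \<Longrightarrow> iteration V search s t (s(v \<mapsto> x))"

inductive run :: "'a set \<Rightarrow> 'a search \<Rightarrow> 'a signing \<Rightarrow> nat \<Rightarrow> bool" for V search where
  start: "run V search Map.empty 0"
| iterate: "\<lbrakk>run V search s T; iteration V search s t s'\<rbrakk> \<Longrightarrow> run V search s' (T + t)"

definition halts_with :: "'a set \<Rightarrow> 'a search \<Rightarrow> 'a signing \<Rightarrow> nat \<Rightarrow> bool" where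
  "halts_with V search s T \<longleftrightarrow> run V search s T \<and> (\<nexists>t s'. iteration V search s t s')"

definition terminates :: "'a set \<Rightarrow> 'a search \<Rightarrow> bool" where
  "terminates V search \<longleftrightarrow>
     (\<nexists>S :: nat \<Rightarrow> 'a signing. S 0 = Map.empty \<and> (\<forall>i. \<exists>t. iteration V search (S i) t (S (Suc i))))"

end

theory Submission
  imports Defs
begin

text \<open>
  Both algorithms are instances of one scheme. Call a nonempty set \<open>A\<close> a \<^emph>\<open>demand\<close> for the sign
  \<open>x\<close> if the signing sought must give some element of \<open>A\<close> the sign \<open>x\<close>. For \<open>x = Pos\<close> the demands
  are the members of \<open>F\<close> (respectively the intersections of two members), for \<open>x = Neg\<close> they are
  the complements of members (respectively of unions of two members). In these terms the two signs
  are interchangeable: \<open>v\<close> is forced to \<open>x\<close> iff a demand for \<open>x\<close> contains \<open>v\<close> and all its other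
  elements have the opposite sign, and the forcing is trivial iff the demand is \<open>{v}\<close>.

  The algorithm succeeds because no demand ever becomes violated, that is, entirely signed
  with the wrong sign. Suppose that giving \<open>v\<close> the sign \<open>x\<close> violates a demand \<open>A\<close> for the opposite
  sign, for the first time. Then \<open>A\<close> forced \<open>v\<close> to the opposite sign, so \<open>v\<close> was not free
  and was also forced to \<open>x\<close>, by some demand \<open>B\<close>. The elements of \<open>A\<close> other than \<open>v\<close> have sign \<open>x\<close>
  and those of \<open>B\<close> have the opposite sign, so \<open>A\<close> and \<open>B\<close> meet in \<open>v\<close> only. If
  neither of them is \<open>{v}\<close>, the crossing property yields a demand inside \<open>A - B = A - {v}\<close>
  (\<open>uncross\<close>), which was violated already. Hence \<open>v\<close> was trivially forced. Trivially
  forced elements are signed first (\<open>trivially_signed_first_step\<close>), so every element of \<open>A\<close> got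
  the sign \<open>x\<close> trivially: each singleton in \<open>A\<close> is a demand for \<open>x\<close>. This is what the
  hypotheses of the theorem exclude (\<open>escape\<close>).

  An iteration started with \<open>k\<close> unsigned elements signs exactly one of them in time at most
  \<open>c * k\<close>, which gives termination and, summing over \<open>k\<close>, the bound on the running time.
\<close>

section \<open>Demands\<close>

fun opposite :: "sign \<Rightarrow> sign" where
  "opposite Pos = Neg"
| "opposite Neg = Pos"

lemma opposite_opposite [simp]: "opposite (opposite x) = x"
  by (cases x) auto

lemma neq_opposite [simp]: "x \<noteq> opposite x" "opposite x \<noteq> x"
  by (cases x; simp)+

lemma neq_iff_opposite: "y \<noteq> x \<longleftrightarrow> y = opposite x"
  by (cases x; cases y) auto

fun region :: "'a set \<Rightarrow> sign \<Rightarrow> 'a set \<Rightarrow> 'a set" where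
  "region V Pos S = S"
| "region V Neg S = V - S"

definition demands :: "'a set \<Rightarrow> (sign \<Rightarrow> 'a set set) \<Rightarrow> sign \<Rightarrow> 'a set set" where
  "demands V fam x = region V x ` fam x - {{}}"

lemma forces_iff:
  "forces V s S v x \<longleftrightarrow> v \<in> unsigned V s \<and> v \<in> region V x S \<and>
     (\<forall>u\<in>region V x S - {v}. s u = Some (opposite x))"
  by (cases x) (auto simp: unsigned_def)

lemma trivially_forces_iff:
  assumes "S \<subseteq> V"
  shows "trivially_forces V s S v x \<longleftrightarrow> v \<in> unsigned V s \<and> region V x S = {v}"
  using assms by (cases x) (auto simp: unsigned_def)

section \<open>Forcing algorithms\<close>

text \<open>
  The assumption \<open>uncross_Pos_Neg\<close> is what remains of the crossing property in terms of demands,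
  and \<open>escape\<close> is the hypothesis that keeps the trivial phase from violating a demand. The constant \<open>c\<close> bounds the
  number of inspections in a search.
\<close>
locale forcing_algorithm =
  fixes V :: "'a set" and search :: "'a search" and fam :: "sign \<Rightarrow> 'a set set" and c :: nat
  assumes finite_V: "finite V"
    and fam_subset: "S \<in> fam x \<Longrightarrow> S \<subseteq> V"
    and search_Some: "search k R (Some (v, x)) t \<Longrightarrow> (\<exists>S\<in>fam x. R S v x) \<and> t \<le> c * k"
    and search_Some_ex: "S \<in> fam x \<Longrightarrow> R S v x \<Longrightarrow> \<exists>t. search k R (Some (v, x)) t"
    and search_None: "search k R None t \<Longrightarrow> (\<forall>x. \<forall>S\<in>fam x. \<forall>v. \<not> R S v x) \<and> t \<le> c * k"
    and search_None_ex: "\<forall>x. \<forall>S\<in>fam x. \<forall>v. \<not> R S v x \<Longrightarrow> \<exists>t. search k R None t"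
    and uncross_Pos_Neg: "\<lbrakk>A \<in> demands V fam Pos; B \<in> demands V fam Neg; A - B \<noteq> {}; B - A \<noteq> {}\<rbrakk>
      \<Longrightarrow> (\<exists>A'\<in>demands V fam Pos. A' \<subseteq> A - B) \<and> (\<exists>B'\<in>demands V fam Neg. B' \<subseteq> B - A)"
    and escape: "A \<in> demands V fam x \<Longrightarrow> \<exists>u\<in>A. {u} \<notin> demands V fam (opposite x)"
begin

text \<open>
  The roles of the two signs in \<open>uncross_Pos_Neg\<close> can be exchanged, since its conclusion
  provides for both demands. This makes the rest of the argument symmetric in the signs.
\<close>
lemma uncross:
  assumes "A \<in> demands V fam x" "B \<in> demands V fam (opposite x)" "A - B \<noteq> {}" "B - A \<noteq> {}"
  shows "\<exists>A'\<in>demands V fam x. A' \<subseteq> A - B"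
  using assms uncross_Pos_Neg[of A B] uncross_Pos_Neg[of B A] by (cases x) auto

definition forced_to :: "'a signing \<Rightarrow> 'a \<Rightarrow> sign \<Rightarrow> bool" where
  "forced_to s v x \<longleftrightarrow> v \<in> unsigned V s \<and>
     (\<exists>A\<in>demands V fam x. v \<in> A \<and> (\<forall>u\<in>A - {v}. s u = Some (opposite x)))"

definition trivially_forced_to :: "'a signing \<Rightarrow> 'a \<Rightarrow> sign \<Rightarrow> bool" where
  "trivially_forced_to s v x \<longleftrightarrow> v \<in> unsigned V s \<and> {v} \<in> demands V fam x"

lemma trivially_forced_imp_forced: "trivially_forced_to s v x \<Longrightarrow> forced_to s v x"
  by (auto simp: trivially_forced_to_def forced_to_def)

lemma ex_forces_iff: "(\<exists>S\<in>fam x. forces V s S v x) \<longleftrightarrow> forced_to s v x"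
  unfolding forces_iff forced_to_def demands_def by blast

lemma ex_trivially_forces_iff:
  "(\<exists>S\<in>fam x. trivially_forces V s S v x) \<longleftrightarrow> trivially_forced_to s v x"
proof -
  have "(\<exists>S\<in>fam x. trivially_forces V s S v x) \<longleftrightarrow>
      (\<exists>S\<in>fam x. v \<in> unsigned V s \<and> {v} = region V x S)"
    by (intro bex_cong refl, subst trivially_forces_iff[OF fam_subset]) auto
  then show ?thesis
    unfolding trivially_forced_to_def demands_def by blast
qed

lemma search_Some_iff:
  "(\<exists>t. search k R (Some (v, x)) t) \<longleftrightarrow> (\<exists>S\<in>fam x. R S v x)"
  using search_Some search_Some_ex by blast

lemma search_trivial:
  "(\<exists>t. search k (trivially_forces V s) (Some (v, x)) t) \<longleftrightarrow> trivially_forced_to s v x"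
  by (simp only: search_Some_iff ex_trivially_forces_iff)

lemma search_forced: "(\<exists>t. search k (forces V s) (Some (v, x)) t) \<longleftrightarrow> forced_to s v x"
  by (simp only: search_Some_iff ex_forces_iff)

lemma search_free: "(\<exists>t. search k (forces V s) None t) \<longleftrightarrow> (\<nexists>v x. forced_to s v x)"
proof -
  have "(\<exists>t. search k (forces V s) None t) \<longleftrightarrow> (\<forall>x. \<forall>S\<in>fam x. \<forall>v. \<not> forces V s S v x)"
    using search_None search_None_ex by blast
  then show ?thesis
    unfolding ex_forces_iff[symmetric] by blast
qed

lemma iteration_cases:
  assumes "iteration V search s t s'"
  obtains v x where "s' = s(v \<mapsto> x)" "v \<in> unsigned V s" "t \<le> c * card (unsigned V s)"
    "trivially_forced_to s v x \<or>
     (\<nexists>w y. trivially_forced_to s w y) \<and> (forced_to s v x \<or> (\<nexists>w y. forced_to s w y))"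
  using assms
proof cases
  case (trivial v x)
  then have "trivially_forced_to s v x" using search_trivial by blast
  moreover from this have "v \<in> unsigned V s" by (simp add: trivially_forced_to_def)
  ultimately show ?thesis using trivial search_Some by (intro that[of v x]) auto
next
  case (forced v x)
  then have "forced_to s v x" using search_forced by blast
  moreover from this have "v \<in> unsigned V s" by (simp add: forced_to_def)
  moreover have "\<nexists>w y. trivially_forced_to s w y" using forced search_trivial by blast
  ultimately show ?thesis using forced search_Some by (intro that[of v x]) auto
next
  case (free v x)
  then have "\<nexists>w y. forced_to s w y" using search_free by blast
  then show ?thesis using free search_None trivially_forced_imp_forced
    by (intro that[of v x]) blast+
qed

lemma iteration_ex:
  assumes "v \<in> unsigned V s"
  shows "\<exists>t s'. iteration V search s t s'"
proof (cases "\<exists>w y. trivially_forced_to s w y")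
  case True
  then show ?thesis using search_trivial iteration.trivial by metis
next
  case no_trivial: False
  show ?thesis
  proof (cases "\<exists>w y. forced_to s w y")
    case True
    then show ?thesis
      using no_trivial search_trivial search_forced iteration.forced by metis
  next
    case False
    then show ?thesis using assms search_free iteration.free by metis
  qed
qed

section \<open>Termination and running time\<close>

lemma unsigned_update: "unsigned V (s(v \<mapsto> x)) = unsigned V s - {v}"
  by (auto simp: unsigned_def)

lemma finite_unsigned: "finite (unsigned V s)"
  using finite_V by (simp add: unsigned_def)

lemma card_unsigned_iteration:
  assumes "iteration V search s t s'"
  shows "card (unsigned V s) = Suc (card (unsigned V s'))"
proof -
  obtain v x where "s' = s(v \<mapsto> x)" "v \<in> unsigned V s"
    using iteration_cases[OF assms] by metis
  then show ?thesis
    using card.remove[OF finite_unsigned] by (simp add: unsigned_update)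
qed

lemma terminating: "terminates V search"
  unfolding terminates_def
proof
  assume "\<exists>S :: nat \<Rightarrow> 'a signing. S 0 = Map.empty \<and>
    (\<forall>i. \<exists>t. iteration V search (S i) t (S (Suc i)))"
  then obtain S :: "nat \<Rightarrow> 'a signing"
    where step: "\<And>i. \<exists>t. iteration V search (S i) t (S (Suc i))" by blast
  have "card (unsigned V (S i)) + i = card (unsigned V (S 0))" for i
  proof (induction i)
    case 0
    show ?case by simp
  next
    case (Suc i)
    obtain t where "iteration V search (S i) t (S (Suc i))" using step by blast
    from Suc card_unsigned_iteration[OF this] show ?case by simp
  qed
  from this[of "Suc (card (unsigned V (S 0)))"] show False by simp
qed

lemma run_time:
  assumes "run V search s T"
  shows "T + c * (Suc (card (unsigned V s)) choose 2) \<le> c * (Suc (card V) choose 2)"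
  using assms
proof induction
  case start
  then show ?case by (simp add: unsigned_def)
next
  case (iterate s T t s')
  let ?k = "card (unsigned V s)"
  have "t \<le> c * ?k" using iteration_cases[OF iterate.hyps(2)] by metis
  moreover have "(Suc ?k choose 2) = (Suc (card (unsigned V s')) choose 2) + ?k"
    using card_unsigned_iteration[OF iterate.hyps(2)] by (simp add: numeral_2_eq_2)
  ultimately show ?case using iterate.IH by (simp add: distrib_left)
qed

section \<open>Correctness\<close>

definition trivially_signed_first :: "'a signing \<Rightarrow> bool" where
  "trivially_signed_first s \<longleftrightarrow> (\<exists>v x. trivially_forced_to s v x) \<longrightarrow>
     (\<forall>v x. s v = Some x \<longrightarrow> {v} \<in> demands V fam x)"

definition unviolated :: "'a signing \<Rightarrow> bool" where
  "unviolated s \<longleftrightarrow> (\<forall>x. \<forall>A\<in>demands V fam x. \<exists>u\<in>A. s u \<noteq> Some (opposite x))"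

lemma unviolatedE:
  assumes "unviolated s" "A \<in> demands V fam x"
  obtains u where "u \<in> A" "s u \<noteq> Some (opposite x)"
proof -
  from assms have "\<exists>u\<in>A. s u \<noteq> Some (opposite x)"
    unfolding unviolated_def by (elim allE ballE) auto
  with that show ?thesis by blast
qed

text \<open>
  Signing an element can only remove trivially forced elements. So if some are left afterwards,
  there were some before, and the iteration had to sign one of them.
\<close>
lemma trivially_signed_first_step:
  assumes "iteration V search s t s'" "trivially_signed_first s"
  shows "trivially_signed_first s'"
  unfolding trivially_signed_first_def
proof
  assume "\<exists>w y. trivially_forced_to s' w y"
  obtain v x where s': "s' = s(v \<mapsto> x)" and
    cases: "trivially_forced_to s v x \<or> (\<nexists>w y. trivially_forced_to s w y)"
    using iteration_cases[OF assms(1)] by metis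
  have before: "\<exists>w y. trivially_forced_to s w y"
    using \<open>\<exists>w y. trivially_forced_to s' w y\<close>
    by (auto simp: s' trivially_forced_to_def unsigned_update)
  with cases have "{v} \<in> demands V fam x" by (auto simp: trivially_forced_to_def)
  moreover have "\<forall>w y. s w = Some y \<longrightarrow> {w} \<in> demands V fam y"
    using before assms(2) by (simp add: trivially_signed_first_def)
  ultimately show "\<forall>w y. s' w = Some y \<longrightarrow> {w} \<in> demands V fam y"
    by (auto simp: s')
qed

text \<open>
  The uncrossing argument: a demand violated by this step and the demand that forced the step
  meet only in the new element, so outside the trivial phase a smaller demand was violated before.
\<close>
lemma unviolated_step:
  assumes iter: "iteration V search s t s'" and phase: "trivially_signed_first s" and "unviolated s"
  shows "unviolated s'"
  unfolding unviolated_def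
proof (intro allI ballI, rule ccontr)
  fix x A
  assume A: "A \<in> demands V fam x" and "\<not> (\<exists>u\<in>A. s' u \<noteq> Some (opposite x))"
  then have wrong: "\<forall>u\<in>A. s' u = Some (opposite x)" by blast
  obtain v y where s': "s' = s(v \<mapsto> y)" and v: "v \<in> unsigned V s" and
    cases: "trivially_forced_to s v y \<or>
      (\<nexists>w z. trivially_forced_to s w z) \<and> (forced_to s v y \<or> (\<nexists>w z. forced_to s w z))"
    using iteration_cases[OF iter] by metis
  obtain u where "u \<in> A" "s u \<noteq> Some (opposite x)"
    using unviolatedE[OF \<open>unviolated s\<close> A] by metis
  moreover from this have "s' u = Some (opposite x)" using wrong by blast
  ultimately have vA: "v \<in> A" and y: "y = opposite x"
    by (auto simp: s' split: if_splits)
  have rest_A: "\<forall>u\<in>A - {v}. s u = Some (opposite x)"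
  proof
    fix u assume "u \<in> A - {v}"
    then have "s' u = Some (opposite x)" "u \<noteq> v" using wrong by blast+
    then show "s u = Some (opposite x)" by (simp add: s')
  qed
  have forced_x: "forced_to s v x" using A v vA rest_A unfolding forced_to_def by blast
  from cases show False
  proof
    assume trivial: "trivially_forced_to s v y"
    then have "\<forall>w z. s w = Some z \<longrightarrow> {w} \<in> demands V fam z"
      using phase by (auto simp: trivially_signed_first_def)
    with rest_A trivial have "\<forall>u\<in>A. {u} \<in> demands V fam (opposite x)"
      by (auto simp: y trivially_forced_to_def)
    with escape[OF A] show False by blast
  next
    assume nontrivial: "(\<nexists>w z. trivially_forced_to s w z) \<and>
      (forced_to s v y \<or> (\<nexists>w z. forced_to s w z))"
    then have "forced_to s v (opposite x)" using forced_x y by blast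
    then obtain B where B: "B \<in> demands V fam (opposite x)" "v \<in> B"
      and rest_B: "\<forall>u\<in>B - {v}. s u = Some x"
      by (auto simp: forced_to_def)
    have "A \<noteq> {v}" "B \<noteq> {v}"
      using A B v nontrivial by (auto simp: trivially_forced_to_def)
    moreover have meet: "A \<inter> B = {v}" 
    proof -
      have "u = v" if "u \<in> A" "u \<in> B" for u
      proof (rule ccontr)
        assume "u \<noteq> v"
        with that rest_A rest_B have "s u = Some (opposite x)" "s u = Some x" by blast+
        then show False by simp
      qed
      with vA B show ?thesis by blast
    qed
    ultimately have "A - B \<noteq> {}" "B - A \<noteq> {}" by blast+
    with uncross[OF A B(1)] obtain A' where "A' \<in> demands V fam x" "A' \<subseteq> A - B" by blast
    from unviolatedE[OF \<open>unviolated s\<close> this(1)] obtain u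
      where "u \<in> A'" "s u \<noteq> Some (opposite x)" .
    with \<open>A' \<subseteq> A - B\<close> meet rest_A show False by blast
  qed
qed

lemma run_invariants:
  assumes "run V search s T"
  shows "dom s \<subseteq> V \<and> trivially_signed_first s \<and> unviolated s"
  using assms
proof induction
  case start
  have "\<exists>u. u \<in> A" if "A \<in> demands V fam x" for A x
    using that by (auto simp: demands_def)
  then show ?case by (auto simp: trivially_signed_first_def unviolated_def)
next
  case (iterate s T t s')
  have "dom s' \<subseteq> V"
  proof -
    obtain v x where "s' = s(v \<mapsto> x)" "v \<in> unsigned V s"
      using iteration_cases[OF iterate.hyps(2)] by metis
    with iterate.IH show ?thesis by (auto simp: unsigned_def)
  qed
  with iterate show ?case using trivially_signed_first_step unviolated_step by blast
qed

text \<open>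
  Only a fully signed state has no successor, and for it being unviolated means that all demands
  are met.
\<close>
lemma output_correct:
  assumes "halts_with V search s T"
  shows "dom s = V" and "T \<le> c * ((card V + 1) choose 2)"
    and "A \<in> demands V fam x \<Longrightarrow> \<exists>u\<in>A. the (s u) = x"
proof -
  have run: "run V search s T" and "unsigned V s = {}"
    using assms iteration_ex by (auto simp: halts_with_def)
  then have full: "V \<subseteq> dom s" by (auto simp: unsigned_def)
  with run_invariants[OF run] show "dom s = V" by blast
  show "T \<le> c * ((card V + 1) choose 2)" using run_time[OF run] by simp
  assume A: "A \<in> demands V fam x"
  then obtain u where u: "u \<in> A" "s u \<noteq> Some (opposite x)"
    using run_invariants[OF run] unviolatedE by metis
  have "A \<subseteq> V" using A fam_subset by (cases x) (auto simp: demands_def)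
  with u(1) full obtain y where "s u = Some y" by blast
  with u(2) have "the (s u) = x" by (metis neq_iff_opposite opposite_opposite option.sel)
  with u show "\<exists>u\<in>A. the (s u) = x" by blast
qed

end

section \<open>The two algorithms\<close>

lemma crossing_familyD:
  assumes "crossing_family V F" "U \<in> F" "W \<in> F" "a \<in> U" "a \<in> W" "b \<in> V" "b \<notin> U" "b \<notin> W"
  shows "U \<inter> W \<in> F" "U \<union> W \<in> F"
  using assms unfolding crossing_family_def by blast+

lemma cosigning_forcing_algorithm:
  assumes "finite V" and F: "F \<subseteq> Pow V - {{}, V}" and cross: "crossing_family V F"
    and witness: "\<forall>U\<in>F. (\<exists>u\<in>U. V - {u} \<notin> F) \<and> (\<exists>v\<in>V - U. {v} \<notin> F)"
  shows "forcing_algorithm V (cosigning_search F) (\<lambda>_. F) (card F)"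
proof
  show "finite V" by fact
  fix S and x :: sign assume "S \<in> F" then show "S \<subseteq> V" using F by blast
next
  have finite_F: "finite F" using F \<open>finite V\<close> by (meson finite_Diff finite_Pow_iff finite_subset)
  fix k R v x t assume "cosigning_search F k R (Some (v, x)) t"
  then show "(\<exists>S\<in>F. R S v x) \<and> t \<le> card F * k"
  proof cases
    case (found I U)
    then have "card I * k \<le> card F * k" using finite_F by (simp add: card_mono)
    with found show ?thesis by (meson le_trans subsetD)
  qed
next
  fix S x and R :: "'a set \<Rightarrow> 'a \<Rightarrow> sign \<Rightarrow> bool" and v k
  assume "S \<in> F" "R S v x"
  then have "cosigning_search F k R (Some (v, x)) 0"
    by (intro cosigning_search.found[of "{S}"]) auto
  then show "\<exists>t. cosigning_search F k R (Some (v, x)) t" ..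
next
  fix k R t assume "cosigning_search F k R None t"
  then show "(\<forall>x. \<forall>S\<in>F. \<forall>v. \<not> R S v x) \<and> t \<le> card F * k" by cases auto
next
  fix R :: "'a set \<Rightarrow> 'a \<Rightarrow> sign \<Rightarrow> bool" and k
  assume "\<forall>x. \<forall>S\<in>F. \<forall>v. \<not> R S v x"
  then have "cosigning_search F k R None 0" by (intro cosigning_search.exhausted) auto
  then show "\<exists>t. cosigning_search F k R None t" ..
next
  fix A B
  assume "A \<in> demands V (\<lambda>_. F) Pos" "B \<in> demands V (\<lambda>_. F) Neg" "A - B \<noteq> {}" "B - A \<noteq> {}"
  then obtain W a b where A: "A \<in> F" and W: "W \<in> F" and B: "B = V - W"
    and a: "a \<in> A - B" and b: "b \<in> B - A"
    by (auto simp: demands_def)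
  have "a \<in> W" using A F a B by blast
  then have "A \<inter> W \<in> F" "A \<union> W \<in> F"
    using crossing_familyD[OF cross A W, of a b] a b B by auto
  moreover have "A \<inter> W \<noteq> {}" "A \<inter> W \<subseteq> A - B" "V - (A \<union> W) \<noteq> {}" "V - (A \<union> W) \<subseteq> B - A"
    using a b \<open>a \<in> W\<close> B by auto
  ultimately show "(\<exists>A'\<in>demands V (\<lambda>_. F) Pos. A' \<subseteq> A - B) \<and>
      (\<exists>B'\<in>demands V (\<lambda>_. F) Neg. B' \<subseteq> B - A)"
    by (intro conjI bexI[of _ "A \<inter> W"] bexI[of _ "V - (A \<union> W)"])
      (auto simp: demands_def simp del: Diff_eq_empty_iff)
next
  fix A x assume A: "A \<in> demands V (\<lambda>_. F) x"
  show "\<exists>u\<in>A. {u} \<notin> demands V (\<lambda>_. F) (opposite x)"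
  proof (cases x)
    case Pos
    then obtain u where u: "u \<in> A" "V - {u} \<notin> F" using A witness by (auto simp: demands_def)
    have "S = V - {u}" if "S \<in> F" "{u} = V - S" for S using that F by blast
    with u Pos show ?thesis by (intro bexI[of _ u]) (auto simp: demands_def)
  next
    case Neg
    then show ?thesis using A witness by (auto simp: demands_def)
  qed
qed

fun int_un_family :: "'a set set \<Rightarrow> sign \<Rightarrow> 'a set set" where
  "int_un_family F Pos = {Z \<inter> T | Z T. Z \<in> F \<and> T \<in> F}"
| "int_un_family F Neg = {X \<union> Y | X Y. X \<in> F \<and> Y \<in> F}"

text \<open>
  The intersections of two members need not form a crossing family, but they can still be
  uncrossed against the unions: for \<open>a \<in> Z \<inter> T \<inter> (X \<union> Y)\<close> and \<open>b \<notin> (Z \<inter> T) \<union> X \<union> Y\<close> one of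
  \<open>Z, T\<close> misses \<open>b\<close> and one of \<open>X, Y\<close> contains \<open>a\<close>. Those two cross, and merging just them
  yields again an intersection (a union) of two members.
\<close>
lemma int_un_uncross:
  assumes cross: "crossing_family V F" and F: "F \<subseteq> Pow V"
    and "A \<in> demands V (int_un_family F) Pos" "B \<in> demands V (int_un_family F) Neg"
    and "A - B \<noteq> {}" "B - A \<noteq> {}"
  shows "(\<exists>A'\<in>demands V (int_un_family F) Pos. A' \<subseteq> A - B) \<and>
    (\<exists>B'\<in>demands V (int_un_family F) Neg. B' \<subseteq> B - A)"
proof -
  obtain Z T where ZT: "Z \<in> F" "T \<in> F" and A: "A = Z \<inter> T"
    using assms(3) by (auto simp: demands_def)
  obtain X Y where XY: "X \<in> F" "Y \<in> F" and B: "B = V - (X \<union> Y)"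
    using assms(4) by (auto simp: demands_def)
  obtain a b where a: "a \<in> A - B" and b: "b \<in> B - A"
    using assms(5,6) by blast
  obtain Z' T' where ZT': "Z' \<in> F" "T' \<in> F" "A = Z' \<inter> T'" "b \<notin> Z'"
    using ZT A b by (metis DiffE IntI Int_commute)
  have "a \<in> X \<union> Y" using a A B ZT F by blast
  then obtain X' Y' where XY': "X' \<in> F" "Y' \<in> F" "B = V - (X' \<union> Y')" "a \<in> X'"
    using XY B by (metis UnE Un_commute)
  have crossed: "Z' \<inter> X' \<in> F" "Z' \<union> X' \<in> F"
    using crossing_familyD[OF cross ZT'(1) XY'(1), of a b] a b ZT' XY' by auto
  have "Z' \<inter> X' \<inter> T' \<in> demands V (int_un_family F) Pos"
    using crossed ZT' XY' a by (auto simp: demands_def)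
  moreover have "V - (Z' \<union> X' \<union> Y') \<in> demands V (int_un_family F) Neg"
  proof -
    have "V - (Z' \<union> X' \<union> Y') \<noteq> {}" using b ZT' XY' by blast
    moreover have "(Z' \<union> X') \<union> Y' \<in> int_un_family F Neg" using crossed XY' by auto
    ultimately show ?thesis by (force simp: demands_def simp del: int_un_family.simps)
  qed
  moreover have "Z' \<inter> X' \<inter> T' \<subseteq> A - B" "V - (Z' \<union> X' \<union> Y') \<subseteq> B - A"
    using ZT' XY' by auto
  ultimately show ?thesis by blast
qed

lemma int_un_forcing_algorithm:
  assumes "finite V" and F: "F \<subseteq> Pow V - {{}, V}" and cross: "crossing_family V F"
    and witness_Pos: "\<forall>Z\<in>F. \<forall>T\<in>F. Z \<inter> T \<noteq> {} \<longrightarrow>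
      (\<exists>u\<in>Z \<inter> T. \<forall>B\<in>F. \<forall>W\<in>F. V - {u} \<noteq> B \<union> W)"
    and witness_Neg: "\<forall>X\<in>F. \<forall>Y\<in>F. X \<union> Y \<noteq> V \<longrightarrow>
      (\<exists>v\<in>V - (X \<union> Y). \<forall>H\<in>F. \<forall>G\<in>F. {v} \<noteq> H \<inter> G)"
  shows "forcing_algorithm V (int_un_search F) (int_un_family F) (2 * (card F choose 2))"
proof
  show "finite V" by fact
  fix S x assume "S \<in> int_un_family F x" then show "S \<subseteq> V" using F by (cases x) auto
next
  have finite_F: "finite F" using F \<open>finite V\<close> by (meson finite_Diff finite_Pow_iff finite_subset)
  have finite_pairs: "finite (set_pairs F)" using finite_F by (simp add: set_pairs_def)
  have card_pairs: "card (set_pairs F) = card F choose 2"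
    unfolding set_pairs_def by (rule n_subsets[OF finite_F])
  have cost: "t \<le> 2 * (card F choose 2) * k"
    if "I \<subseteq> set_pairs F" "J \<subseteq> set_pairs F" "t \<le> (card I + card J) * k" for I J t k
  proof -
    have "card I + card J \<le> 2 * (card F choose 2)"
      using that card_mono[OF finite_pairs, of I] card_mono[OF finite_pairs, of J]
      by (simp add: card_pairs)
    with that(3) show ?thesis by (meson le_trans mult_le_mono1)
  qed
  show "(\<exists>S\<in>int_un_family F x. R S v x) \<and> t \<le> 2 * (card F choose 2) * k"
    if "int_un_search F k R (Some (v, x)) t" for k R v x t
    using that
  proof cases
    case (found_pos I J Z T)
    then have "Z \<inter> T \<in> int_un_family F x" by auto
    with found_pos cost show ?thesis by blast
  next
    case (found_neg I J X Y)
    then have "X \<union> Y \<in> int_un_family F x" by auto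
    with found_neg cost show ?thesis by blast
  qed
  show "(\<forall>x. \<forall>S\<in>int_un_family F x. \<forall>v. \<not> R S v x) \<and> t \<le> 2 * (card F choose 2) * k"
    if "int_un_search F k R None t" for k R t
    using that
  proof cases
    case exhausted
    have "\<not> R S v x" if "S \<in> int_un_family F x" for S v x
      using that exhausted by (cases x) auto
    with cost[OF order_refl order_refl exhausted(3)] show ?thesis by blast
  qed
next
  fix S x and R :: "'a set \<Rightarrow> 'a \<Rightarrow> sign \<Rightarrow> bool" and v k
  assume S: "S \<in> int_un_family F x" and R: "R S v x"
  have pair: "{P, Q} \<in> set_pairs F" if "P \<in> F" "Q \<in> F" "P \<noteq> Q" for P Q
    using that by (simp add: set_pairs_def)
  have "int_un_search F k R (Some (v, x)) 0"
  proof (cases x)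
    case Pos
    then obtain Z T where ZT: "Z \<in> F" "T \<in> F" "S = Z \<inter> T" using S by auto
    (* The intersection is empty if the two witnesses coincide, as such pairs are not counted. *)
    then have "Z = T \<or> {Z, T} \<in> {{Z, T}} \<inter> set_pairs F" using pair by blast
    from int_un_search.found_pos[OF Int_lower2 empty_subsetI ZT(1,2) this] have
      "int_un_search F k R (Some (v, Pos)) 0" using R Pos ZT(3) by simp
    with Pos show ?thesis by simp
  next
    case Neg
    then obtain X Y where XY: "X \<in> F" "Y \<in> F" "S = X \<union> Y" using S by auto
    then have "X = Y \<or> {X, Y} \<in> {{X, Y}} \<inter> set_pairs F" using pair by blast
    from int_un_search.found_neg[OF empty_subsetI Int_lower2 XY(1,2) this] have
      "int_un_search F k R (Some (v, Neg)) 0" using R Neg XY(3) by simp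
    with Neg show ?thesis by simp
  qed
  then show "\<exists>t. int_un_search F k R (Some (v, x)) t" ..
next
  fix R :: "'a set \<Rightarrow> 'a \<Rightarrow> sign \<Rightarrow> bool" and k
  assume none: "\<forall>x. \<forall>S\<in>int_un_family F x. \<forall>v. \<not> R S v x"
  have "\<not> R (Z \<inter> T) v Pos" "\<not> R (Z \<union> T) v Neg" if "Z \<in> F" "T \<in> F" for Z T v
    using that none[rule_format, of "Z \<inter> T" Pos v] none[rule_format, of "Z \<union> T" Neg v]
    by auto
  then have "int_un_search F k R None 0"
    by (intro int_un_search.exhausted) auto
  then show "\<exists>t. int_un_search F k R None t" ..
next
  fix A B
  assume "A \<in> demands V (int_un_family F) Pos" "B \<in> demands V (int_un_family F) Neg"
    "A - B \<noteq> {}" "B - A \<noteq> {}"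
  then show "(\<exists>A'\<in>demands V (int_un_family F) Pos. A' \<subseteq> A - B) \<and>
      (\<exists>B'\<in>demands V (int_un_family F) Neg. B' \<subseteq> B - A)"
    using int_un_uncross[OF cross] F by blast
next
  fix A x assume A: "A \<in> demands V (int_un_family F) x"
  show "\<exists>u\<in>A. {u} \<notin> demands V (int_un_family F) (opposite x)"
  proof (cases x)
    case Pos
    then obtain Z T where ZT: "Z \<in> F" "T \<in> F" "A = Z \<inter> T" "Z \<inter> T \<noteq> {}"
      using A by (auto simp: demands_def)
    with witness_Pos obtain u where u: "u \<in> A" "\<forall>B\<in>F. \<forall>W\<in>F. V - {u} \<noteq> B \<union> W"
      by metis
    have "{u} \<notin> demands V (int_un_family F) Neg"
    proof
      assume "{u} \<in> demands V (int_un_family F) Neg"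
      then obtain B W where BW: "B \<in> F" "W \<in> F" and "{u} = V - (B \<union> W)"
        by (auto simp: demands_def)
      then have "V - {u} = B \<union> W" using F by blast
      with u(2) BW show False by blast
    qed
    with u(1) Pos show ?thesis by auto
  next
    case Neg
    then obtain X Y where XY: "X \<in> F" "Y \<in> F" "A = V - (X \<union> Y)" "A \<noteq> {}"
      using A by (auto simp: demands_def)
    then have "X \<union> Y \<noteq> V" by blast
    with XY witness_Neg obtain v where v: "v \<in> A" "\<forall>H\<in>F. \<forall>G\<in>F. {v} \<noteq> H \<inter> G"
      by metis
    have "{v} \<notin> demands V (int_un_family F) Pos"
    proof
      assume "{v} \<in> demands V (int_un_family F) Pos"
      then obtain H G where "H \<in> F" "G \<in> F" "{v} = H \<inter> G"
        by (auto simp: demands_def)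
      with v(2) show False by blast
    qed
    with v(1) Neg show ?thesis by auto
  qed
qed

theorem mainTheorem5:
  fixes V :: "'a set" and F :: "'a set set" and n m :: nat
  assumes "finite V" and "card V = n"
    and "F \<subseteq> Pow V - {{}, V}" and "crossing_family V F" and "card F = m"
  shows "((\<forall>U\<in>F. (\<exists>u\<in>U. V - {u} \<notin> F) \<and> (\<exists>v\<in>V - U. {v} \<notin> F)) \<longrightarrow>
           terminates V (cosigning_search F) \<and>
           (\<forall>s T. halts_with V (cosigning_search F) s T \<longrightarrow>
              dom s = V \<and> cosigning V F (\<lambda>v. the (s v)) \<and>
              T \<le> m * ((n + 1) choose 2)))
       \<and> ((\<forall>Z\<in>F. \<forall>T\<in>F. Z \<inter> T \<noteq> {} \<longrightarrow>
              (\<exists>u\<in>Z \<inter> T. \<forall>B\<in>F. \<forall>W\<in>F. V - {u} \<noteq> B \<union> W)) \<and>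
          (\<forall>X\<in>F. \<forall>Y\<in>F. X \<union> Y \<noteq> V \<longrightarrow>
              (\<exists>v\<in>V - (X \<union> Y). \<forall>H\<in>F. \<forall>G\<in>F. {v} \<noteq> H \<inter> G)) \<longrightarrow>
           terminates V (int_un_search F) \<and>
           (\<forall>s T. halts_with V (int_un_search F) s T \<longrightarrow>
              dom s = V \<and> int_un_closed_cosigning V F (\<lambda>v. the (s v)) \<and>
              T \<le> 2 * (m choose 2) * ((n + 1) choose 2)))"
proof (intro conjI[of "_ \<longrightarrow> _"] impI)
  assume "\<forall>U\<in>F. (\<exists>u\<in>U. V - {u} \<notin> F) \<and> (\<exists>v\<in>V - U. {v} \<notin> F)"
  then interpret forcing_algorithm V "cosigning_search F" "\<lambda>_. F" "card F"
    using assms by (intro cosigning_forcing_algorithm)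
  have "cosigning V F (\<lambda>v. the (s v))" if "halts_with V (cosigning_search F) s T" for s T
    unfolding cosigning_def
  proof
    fix U assume "U \<in> F"
    then have "U \<in> demands V (\<lambda>_. F) Pos" "V - U \<in> demands V (\<lambda>_. F) Neg"
      using assms(3) by (auto simp: demands_def)
    then show "(\<exists>u\<in>U. the (s u) = Pos) \<and> (\<exists>v\<in>V - U. the (s v) = Neg)"
      using output_correct(3)[OF that] by blast
  qed
  with terminating output_correct(1,2)
  show "terminates V (cosigning_search F) \<and>
      (\<forall>s T. halts_with V (cosigning_search F) s T \<longrightarrow>
        dom s = V \<and> cosigning V F (\<lambda>v. the (s v)) \<and> T \<le> m * ((n + 1) choose 2))"
    unfolding assms(2)[symmetric] assms(5)[symmetric] by blast
next
  have F: "F \<subseteq> Pow V" using assms(3) by blast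
  assume "(\<forall>Z\<in>F. \<forall>T\<in>F. Z \<inter> T \<noteq> {} \<longrightarrow>
        (\<exists>u\<in>Z \<inter> T. \<forall>B\<in>F. \<forall>W\<in>F. V - {u} \<noteq> B \<union> W)) \<and>
      (\<forall>X\<in>F. \<forall>Y\<in>F. X \<union> Y \<noteq> V \<longrightarrow>
        (\<exists>v\<in>V - (X \<union> Y). \<forall>H\<in>F. \<forall>G\<in>F. {v} \<noteq> H \<inter> G))"
  then interpret forcing_algorithm V "int_un_search F" "int_un_family F" "2 * (card F choose 2)"
    using assms by (intro int_un_forcing_algorithm) blast+
  have "int_un_closed_cosigning V F (\<lambda>v. the (s v))"
    if "halts_with V (int_un_search F) s T" for s T
    unfolding int_un_closed_cosigning_def
  proof (intro conjI ballI impI)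
    fix X Y assume "X \<in> F" "Y \<in> F" "X \<inter> Y \<noteq> {}"
    then have "X \<inter> Y \<in> demands V (int_un_family F) Pos" by (auto simp: demands_def)
    then show "\<exists>u\<in>X \<inter> Y. the (s u) = Pos" by (rule output_correct(3)[OF that])
  next
    fix X Y assume "X \<in> F" "Y \<in> F" "X \<union> Y \<noteq> V"
    then have "X \<union> Y \<in> int_un_family F Neg" "V - (X \<union> Y) \<noteq> {}"
      using F by auto
    then have "V - (X \<union> Y) \<in> demands V (int_un_family F) Neg"
      by (force simp: demands_def simp del: int_un_family.simps)
    then show "\<exists>v\<in>V - (X \<union> Y). the (s v) = Neg" by (rule output_correct(3)[OF that])
  qed
  with terminating output_correct(1,2)
  show "terminates V (int_un_search F) \<and>
      (\<forall>s T. halts_with V (int_un_search F) s T \<longrightarrow>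
        dom s = V \<and> int_un_closed_cosigning V F (\<lambda>v. the (s v)) \<and>
        T \<le> 2 * (m choose 2) * ((n + 1) choose 2))"
    unfolding assms(2)[symmetric] assms(5)[symmetric] by blast
qed

end
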